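(* Let $G$ and $H$ be controllable graphs. Then $G$ and $H$ are isomorphic if and only if they are $C^2$-equivalent.
   Context: All graphs are finite and simple. For a graph $G$ on $n$ vertices with adjacency matrix $A$, let $\mathbf{1}$ be the all-ones vector in $\mathbb{R}^n$. The walk matrix of $G$ is the $n\times n$ matrix $W_G=\big[\mathbf{1}\ \ A\mathbf{1}\ \cdots\ A^{n-1}\mathbf{1}\big]$, with rows indexed by the vertices of $G$. The graph $G$ is controllable if $W_G$ is invertible. $C^2$ is the fragment of first-order logic with counting quantifiers, in the language of graphs, whose formulas use at most two distinct variables (each of which may be re-quantified). Formulas are built from atomic formulas $x=y$ and $Exy$ (adjacency), with variables ranging over vertices, using negation, disjunction (and the usual derived connectives), the quantifier $\exists$ (and the derived $\forall$), and for each non-negative integer $d$ the counting quantifier $\exists^{\ge d}$, where $\exists^{\ge d}x\,\phi$ holds in a graph if there are at least $d$ distinct vertices which can be substituted for $x$ to make $\phi$ true. A sentence is a formula without free variables. Two graphs $G$ and $H$ are $C^2$-equivalent if, for every $C^2$-sentence $\phi$, $G\models\phi$ if and only if $H\models\phi$. *)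

theory Defs
  imports
    "Jordan_Normal_Form.Matrix"
    "Graph_Theory.Graph_Theory"
begin

text \<open>
  A finite simple graph is a \<^const>\<open>pair_graph\<close>: a finite vertex set together with a finite,
  symmetric and loop-free set of pairs of vertices. The graph without vertices is included.
  Isomorphism is \<^const>\<open>digraph_iso\<close>, which for such graphs is adjacency-preserving
  bijection of the vertices (proved below).
\<close>

lemma digraph_iso_with_proj_iff:
  assumes "pair_wf_digraph G"
    and "pair_wf_digraph H"
  shows "digraph_iso (with_proj G) (with_proj H) \<longleftrightarrow>
    (\<exists>f. bij_betw f (pverts G) (pverts H) \<and>
         (\<forall>u\<in>pverts G. \<forall>v\<in>pverts G. (u, v) \<in> parcs G \<longleftrightarrow> (f u, f v) \<in> parcs H))"
    (is "?L \<longleftrightarrow> ?R")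
proof
  interpret G: pair_wf_digraph G by fact
  assume ?L
  then obtain h where h: "pre_digraph.digraph_isomorphism (with_proj G) h"
      and H: "with_proj H = app_iso h (with_proj G)"
    unfolding digraph_iso_def by blast
  let ?f = "iso_verts h"
  have "verts (with_proj H) = ?f ` verts (with_proj G)"
    and "arcs (with_proj H) = iso_arcs h ` arcs (with_proj G)"
    and "tail (with_proj H) = iso_tail h" "head (with_proj H) = iso_head h"
    by (simp_all only: H app_iso_simps)
  then have V: "pverts H = ?f ` pverts G" and A: "parcs H = iso_arcs h ` parcs G"
    and t: "iso_tail h = fst" "iso_head h = snd"
    by simp_all
  have inj: "inj_on ?f (pverts G)"
    and ends: "\<And>a. a \<in> parcs G \<Longrightarrow> iso_arcs h a = (?f (fst a), ?f (snd a))"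
    using h by (auto simp: pre_digraph.digraph_isomorphism_def t prod_eq_iff)
  have "(u, v) \<in> parcs G" if uv: "u \<in> pverts G" "v \<in> pverts G" and e: "(?f u, ?f v) \<in> parcs H"
    for u v
  proof -
    from e A obtain a where a: "a \<in> parcs G" "iso_arcs h a = (?f u, ?f v)"
      by (metis imageE)
    then have "?f (fst a) = ?f u" "?f (snd a) = ?f v" by (auto simp: ends)
    moreover have "fst a \<in> pverts G" "snd a \<in> pverts G"
      using a(1) by (simp_all add: G.arc_fst_in_verts G.arc_snd_in_verts)
    ultimately have "a = (u, v)"
      using uv inj by (auto simp: prod_eq_iff dest: inj_onD)
    with a show ?thesis by simp
  qed
  moreover have "(?f u, ?f v) \<in> parcs H" if "(u, v) \<in> parcs G" for u v
    using that A ends[OF that] by (metis fst_conv image_eqI snd_conv)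
  ultimately show ?R
    using inj V by (intro exI[of _ ?f]) (auto simp: bij_betw_def)
next
  interpret G: pair_wf_digraph G by fact
  interpret H: pair_wf_digraph H by fact
  assume ?R
  then obtain f where bij: "bij_betw f (pverts G) (pverts H)"
    and adj: "\<And>u v. u \<in> pverts G \<Longrightarrow> v \<in> pverts G \<Longrightarrow>
      (u, v) \<in> parcs G \<longleftrightarrow> (f u, f v) \<in> parcs H"
    by blast
  from bij have inj: "inj_on f (pverts G)" and V: "f ` pverts G = pverts H"
    by (auto simp: bij_betw_def)
  define h where "h = \<lparr>iso_verts = f, iso_arcs = map_prod f f, iso_head = snd, iso_tail = fst\<rparr>"
  have vG: "u \<in> pverts G \<and> v \<in> pverts G" if "(u, v) \<in> parcs G" for u v
    using that G.arc_fst_in_verts G.arc_snd_in_verts by fastforce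
  have vH: "u \<in> pverts H \<and> v \<in> pverts H" if "(u, v) \<in> parcs H" for u v
    using that H.arc_fst_in_verts H.arc_snd_in_verts by fastforce
  have "inj_on (map_prod f f) (parcs G)"
  proof (rule inj_onI)
    fix a b assume ab: "a \<in> parcs G" "b \<in> parcs G" "map_prod f f a = map_prod f f b"
    obtain u v x y where [simp]: "a = (u, v)" "b = (x, y)" by (cases a, cases b)
    show "a = b" using ab vG[of u v] vG[of x y] inj by (auto dest: inj_onD)
  qed
  then have 1: "pre_digraph.digraph_isomorphism (with_proj G) h"
    using inj assms(1) by (auto simp: pre_digraph.digraph_isomorphism_def h_def wf_digraph_wp_iff)
  have "map_prod f f ` parcs G = parcs H"
  proof (intro equalityI subsetI)
    fix e assume "e \<in> map_prod f f ` parcs G"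
    then show "e \<in> parcs H" using adj vG by auto
  next
    fix e assume e: "e \<in> parcs H"
    obtain x y where xy: "e = (x, y)" by (cases e)
    with e vH V obtain u v where uv: "u \<in> pverts G" "v \<in> pverts G" "x = f u" "y = f v"
      by blast
    with e xy adj have "(u, v) \<in> parcs G" by blast
    then show "e \<in> map_prod f f ` parcs G" using uv xy by (auto intro!: rev_image_eqI)
  qed
  then have "with_proj H = app_iso h (with_proj G)"
    using V by (simp add: app_iso_def with_proj_def h_def)
  with 1 show ?L unfolding digraph_iso_def by blast
qed


text \<open>
  Matrices are indexed by natural numbers, so the adjacency and walk matrices are taken with
  respect to an enumeration \<open>vs\<close> of the vertices. Another enumeration permutes the rows of the
  walk matrix, hence controllability does not depend on it (\<open>controllable_iff\<close> below).
\<close>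

definition vertex_enum :: "'a pair_pre_digraph \<Rightarrow> 'a list \<Rightarrow> bool" where
  "vertex_enum G vs \<longleftrightarrow> distinct vs \<and> set vs = pverts G"

definition adjacency_mat :: "'a pair_pre_digraph \<Rightarrow> 'a list \<Rightarrow> real mat" where
  "adjacency_mat G vs =
    mat (length vs) (length vs) (\<lambda>(i, j). if (vs ! i, vs ! j) \<in> parcs G then 1 else 0)"

definition ones_vec :: "nat \<Rightarrow> real vec" where
  "ones_vec n = vec n (\<lambda>_. 1)"

definition walk_mat :: "'a pair_pre_digraph \<Rightarrow> 'a list \<Rightarrow> real mat" where
  "walk_mat G vs =
    (let n = length vs; A = adjacency_mat G vs
     in mat_of_cols n (map (\<lambda>k. (A ^\<^sub>m k) *\<^sub>v ones_vec n) [0..<n]))"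

definition controllable :: "'a pair_pre_digraph \<Rightarrow> bool" where
  "controllable G \<longleftrightarrow> (\<exists>vs. vertex_enum G vs \<and> invertible_mat (walk_mat G vs))"


datatype fm =
    Eq nat nat
  | Adj nat nat
  | Neg fm
  | Disj fm fm
  | Ex nat fm
  | ExGe nat nat fm  \<comment> \<open>\<open>ExGe d x \<phi>\<close>: at least \<open>d\<close> vertices \<open>x\<close> satisfy \<open>\<phi>\<close>\<close>

primrec vars :: "fm \<Rightarrow> nat set" where
  "vars (Eq x y) = {x, y}"
| "vars (Adj x y) = {x, y}"
| "vars (Neg \<phi>) = vars \<phi>"
| "vars (Disj \<phi> \<psi>) = vars \<phi> \<union> vars \<psi>"
| "vars (Ex x \<phi>) = insert x (vars \<phi>)"
| "vars (ExGe d x \<phi>) = insert x (vars \<phi>)"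

primrec free_vars :: "fm \<Rightarrow> nat set" where
  "free_vars (Eq x y) = {x, y}"
| "free_vars (Adj x y) = {x, y}"
| "free_vars (Neg \<phi>) = free_vars \<phi>"
| "free_vars (Disj \<phi> \<psi>) = free_vars \<phi> \<union> free_vars \<psi>"
| "free_vars (Ex x \<phi>) = free_vars \<phi> - {x}"
| "free_vars (ExGe d x \<phi>) = free_vars \<phi> - {x}"

primrec satisfies :: "'a pair_pre_digraph \<Rightarrow> (nat \<Rightarrow> 'a) \<Rightarrow> fm \<Rightarrow> bool" where
  "satisfies G s (Eq x y) \<longleftrightarrow> s x = s y"
| "satisfies G s (Adj x y) \<longleftrightarrow> (s x, s y) \<in> parcs G"
| "satisfies G s (Neg \<phi>) \<longleftrightarrow> \<not> satisfies G s \<phi>"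
| "satisfies G s (Disj \<phi> \<psi>) \<longleftrightarrow> satisfies G s \<phi> \<or> satisfies G s \<psi>"
| "satisfies G s (Ex x \<phi>) \<longleftrightarrow> (\<exists>v\<in>pverts G. satisfies G (s(x := v)) \<phi>)"
| "satisfies G s (ExGe d x \<phi>) \<longleftrightarrow> d \<le> card {v \<in> pverts G. satisfies G (s(x := v)) \<phi>}"

definition C2_sentence :: "fm \<Rightarrow> bool" where
  "C2_sentence \<phi> \<longleftrightarrow> card (vars \<phi>) \<le> 2 \<and> free_vars \<phi> = {}"

text \<open>
  The truth value of a sentence does not depend on the assignment (\<open>models_iff_satisfies\<close>).
  Assignments are not restricted to vertices here; otherwise there would be none for the graph
  without vertices.
\<close>

definition models :: "'a pair_pre_digraph \<Rightarrow> fm \<Rightarrow> bool" where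
  "models G \<phi> \<longleftrightarrow> (\<forall>s. satisfies G s \<phi>)"

definition C2_equivalent :: "'a pair_pre_digraph \<Rightarrow> 'b pair_pre_digraph \<Rightarrow> bool" where
  "C2_equivalent G H \<longleftrightarrow> (\<forall>\<phi>. C2_sentence \<phi> \<longrightarrow> (models G \<phi> \<longleftrightarrow> models H \<phi>))"

lemma finite_vars: "finite (vars \<phi>)"
  by (induction \<phi>) auto

lemma satisfies_cong:
  "(\<And>x. x \<in> free_vars \<phi> \<Longrightarrow> s x = t x) \<Longrightarrow> satisfies G s \<phi> \<longleftrightarrow> satisfies G t \<phi>"
proof (induction \<phi> arbitrary: s t)
  case (Neg \<phi>)
  then show ?case by (metis free_vars.simps(3) satisfies.simps(3))
next
  case (Disj \<phi> \<psi>)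
  then show ?case by (metis UnI1 UnI2 free_vars.simps(4) satisfies.simps(4))
next
  case (Ex x \<phi>)
  have "satisfies G (s(x := v)) \<phi> = satisfies G (t(x := v)) \<phi>" for v
    using Ex.prems by (intro Ex.IH) auto
  then show ?case by simp
next
  case (ExGe d x \<phi>)
  have "satisfies G (s(x := v)) \<phi> = satisfies G (t(x := v)) \<phi>" for v
    using ExGe.prems by (intro ExGe.IH) auto
  then show ?case by simp
qed auto

lemma models_iff_satisfies:
  "free_vars \<phi> = {} \<Longrightarrow> models G \<phi> \<longleftrightarrow> satisfies G s \<phi>"
  unfolding models_def using satisfies_cong[of \<phi>] by blast


lemma dim_walk_mat [simp]:
  "dim_row (walk_mat G vs) = length vs" "dim_col (walk_mat G vs) = length vs"
  by (simp_all add: walk_mat_def Let_def)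

lemma adjacency_mat_carrier [simp]:
  "adjacency_mat G vs \<in> carrier_mat (length vs) (length vs)"
  by (simp add: adjacency_mat_def)

lemma walk_mat_index:
  assumes "i < length vs" "k < length vs"
  shows "walk_mat G vs $$ (i, k) = ((adjacency_mat G vs ^\<^sub>m k) *\<^sub>v ones_vec (length vs)) $ i"
  using assms by (simp add: walk_mat_def Let_def mat_of_cols_def)

lemma pow_mat_Suc_left:
  assumes A: "A \<in> carrier_mat n n"
  shows "A ^\<^sub>m Suc k = A * (A ^\<^sub>m k :: 'b :: comm_semiring_1 mat)"
proof (induction k)
  case 0
  show ?case using A by simp
next
  case (Suc k)
  have "A ^\<^sub>m Suc (Suc k) = (A * A ^\<^sub>m k) * A" using Suc by simp
  also have "\<dots> = A * (A ^\<^sub>m k * A)" using A by (intro assoc_mult_mat) (auto intro: pow_carrier_mat)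
  finally show ?case by simp
qed

lemma pow_adjacency_Suc:
  assumes "i < length vs"
  shows "((adjacency_mat G vs ^\<^sub>m Suc k) *\<^sub>v ones_vec (length vs)) $ i =
    (\<Sum>j<length vs. (if (vs ! i, vs ! j) \<in> parcs G then 1 else 0) *
       ((adjacency_mat G vs ^\<^sub>m k) *\<^sub>v ones_vec (length vs)) $ j)"
proof -
  let ?n = "length vs" and ?A = "adjacency_mat G vs"
  have A: "?A \<in> carrier_mat ?n ?n" by simp
  have "(?A ^\<^sub>m Suc k) *\<^sub>v ones_vec ?n = ?A *\<^sub>v ((?A ^\<^sub>m k) *\<^sub>v ones_vec ?n)"
    unfolding pow_mat_Suc_left[OF A]
    by (rule assoc_mult_mat_vec[OF A pow_carrier_mat[OF A]]) (simp add: ones_vec_def)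
  then show ?thesis
    using assms A pow_carrier_mat[OF A, of k]
    by (simp add: scalar_prod_def adjacency_mat_def lessThan_atLeast0 del: pow_mat.simps)
qed

lemma walk_vec_enum:
  assumes p: "p permutes {..<length vs}" and i: "i < length vs"
  defines "ws \<equiv> permute_list p vs"
  shows "((adjacency_mat G ws ^\<^sub>m k) *\<^sub>v ones_vec (length ws)) $ i =
    ((adjacency_mat G vs ^\<^sub>m k) *\<^sub>v ones_vec (length vs)) $ (p i)"
  using i
proof (induction k arbitrary: i)
  case 0
  have "p i < length vs" using p 0 by (metis lessThan_iff permutes_in_image)
  then show ?case using 0 by (simp add: ones_vec_def ws_def adjacency_mat_def)
next
  case (Suc k)
  let ?n = "length vs"
  have len: "length ws = ?n" by (simp add: ws_def)
  have pj: "p j < ?n" if "j < ?n" for j using p that by (metis lessThan_iff permutes_in_image)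
  have nth: "ws ! j = vs ! p j" if "j < ?n" for j
    using that p by (simp add: ws_def permute_list_nth)
  let ?v = "\<lambda>j. ((adjacency_mat G vs ^\<^sub>m k) *\<^sub>v ones_vec ?n) $ j"
  have "((adjacency_mat G ws ^\<^sub>m Suc k) *\<^sub>v ones_vec (length ws)) $ i =
      (\<Sum>j<?n. (if (vs ! p i, vs ! p j) \<in> parcs G then 1 else 0) * ?v (p j))"
    using Suc.prems len
    by (subst pow_adjacency_Suc) (auto simp: nth Suc.IH[unfolded len] simp del: pow_mat.simps intro!: sum.cong)
  also have "\<dots> = (\<Sum>j<?n. (if (vs ! p i, vs ! j) \<in> parcs G then 1 else 0) * ?v j)"
    using sum.permute[OF p, of "\<lambda>j. (if (vs ! p i, vs ! j) \<in> parcs G then 1 else 0) * ?v j"]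
    by (simp add: comp_def)
  also have "\<dots> = ((adjacency_mat G vs ^\<^sub>m Suc k) *\<^sub>v ones_vec ?n) $ p i"
    by (rule pow_adjacency_Suc[symmetric]) (rule pj[OF Suc.prems])
  finally show ?case .
qed

lemma invertible_walk_mat_enum:
  assumes vs: "vertex_enum G vs" and ws: "vertex_enum G ws"
    and inv: "invertible_mat (walk_mat G vs)"
  shows "invertible_mat (walk_mat G ws)"
proof -
  let ?n = "length vs"
  have "mset ws = mset vs"
    using vs ws by (metis set_eq_iff_mset_eq_distinct vertex_enum_def)
  then obtain p where p: "p permutes {..<?n}" and ws_eq: "permute_list p vs = ws"
    by (metis mset_eq_permutation)
  have len: "length ws = ?n" using ws_eq by auto
  have pj: "p j < ?n" if "j < ?n" for j using p that by (metis lessThan_iff permutes_in_image)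
  have W: "walk_mat G ws $$ (i, k) = walk_mat G vs $$ (p i, k)" if "i < ?n" "k < ?n" for i k
    using that len pj walk_vec_enum[OF p, of i G k] by (simp add: walk_mat_index ws_eq)
  obtain B where B: "walk_mat G vs * B = 1\<^sub>m ?n" "B * walk_mat G vs = 1\<^sub>m (dim_row B)"
    using inv by (auto simp: invertible_mat_def inverts_mat_def)
  have dimB: "dim_col B = ?n" "dim_row B = ?n"
    using arg_cong[OF B(1), of dim_col] arg_cong[OF B(2), of dim_col] by simp_all
  define C where "C = mat ?n ?n (\<lambda>(i, j). B $$ (i, p j))"
  have prod_index: "(X * Y) $$ (i, j) = (\<Sum>k<?n. X $$ (i, k) * Y $$ (k, j))"
    if "i < ?n" "j < ?n" "dim_row X = ?n" "dim_col X = ?n" "dim_row Y = ?n" "dim_col Y = ?n"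
    for X Y :: "real mat" and i j
    using that by (simp add: scalar_prod_def lessThan_atLeast0)
  have "walk_mat G ws * C = 1\<^sub>m ?n"
  proof (rule eq_matI)
    fix i j assume "i < dim_row (1\<^sub>m ?n)" "j < dim_col (1\<^sub>m ?n)"
    then have ij: "i < ?n" "j < ?n" by simp_all
    have "(walk_mat G ws * C) $$ (i, j) = (walk_mat G vs * B) $$ (p i, p j)"
      using ij pj len dimB by (simp add: prod_index W C_def del: index_mult_mat(1))
    also have "\<dots> = 1\<^sub>m ?n $$ (i, j)"
      using ij pj by (simp add: B(1) inj_eq[OF permutes_inj[OF p]])
    finally show "(walk_mat G ws * C) $$ (i, j) = 1\<^sub>m ?n $$ (i, j)" .
  qed (simp_all add: len C_def)
  moreover have "C * walk_mat G ws = 1\<^sub>m ?n"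
  proof (rule eq_matI)
    fix i j assume "i < dim_row (1\<^sub>m ?n)" "j < dim_col (1\<^sub>m ?n)"
    then have ij: "i < ?n" "j < ?n" by simp_all
    have "(C * walk_mat G ws) $$ (i, j) =
        (\<Sum>k<?n. B $$ (i, p k) * walk_mat G vs $$ (p k, j))"
      using ij len by (simp add: prod_index W C_def del: index_mult_mat(1))
    also have "\<dots> = (\<Sum>k<?n. B $$ (i, k) * walk_mat G vs $$ (k, j))"
      using sum.permute[OF p, of "\<lambda>k. B $$ (i, k) * walk_mat G vs $$ (k, j)"]
      by (simp add: comp_def)
    also have "\<dots> = (B * walk_mat G vs) $$ (i, j)"
      using ij dimB by (simp add: prod_index del: index_mult_mat(1))
    also have "\<dots> = 1\<^sub>m ?n $$ (i, j)" by (simp add: B(2) dimB)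
    finally show "(C * walk_mat G ws) $$ (i, j) = 1\<^sub>m ?n $$ (i, j)" .
  qed (simp_all add: len C_def)
  ultimately show ?thesis
    by (auto simp: invertible_mat_def inverts_mat_def square_mat.simps len C_def intro!: exI[of _ C])
qed

lemma controllable_iff:
  assumes "vertex_enum G vs"
  shows "controllable G \<longleftrightarrow> invertible_mat (walk_mat G vs)"
  using assms invertible_walk_mat_enum unfolding controllable_def by blast

end

theory Submission
  imports Defs
begin

text \<open>
  The number of walks of length \<open>k\<close> starting at a vertex \<open>v\<close> is a function of the \<open>C\<^sup>2\<close>-type of \<open>v\<close>:
  it is the sum of the numbers of walks of length \<open>k - 1\<close> over the neighbours, and the type of
  \<open>v\<close> records how many neighbours of each type \<open>v\<close> has, because among finitely many types each
  one is isolated by a single formula. In a controllable graph the rows of the walk matrix are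
  distinct, so vertices are determined by their types. Hence a sentence says which types occur
  and which pairs of types are adjacent, and matching the vertices of two equivalent
  controllable graphs by type is an isomorphism.
\<close>

section \<open>Isomorphism invariance\<close>

text \<open>Constraining \<open>s\<close> on free variables only makes the condition vacuous for
  sentences. This covers the graph without vertices, into which no assignment maps. Counting
  quantifiers rely on the injectivity of \<open>f\<close>.\<close>

lemma satisfies_iso:
  assumes bij: "bij_betw f (pverts G) (pverts H)"
    and adj: "\<forall>u\<in>pverts G. \<forall>v\<in>pverts G. (u, v) \<in> parcs G \<longleftrightarrow> (f u, f v) \<in> parcs H"
  shows "s ` free_vars \<phi> \<subseteq> pverts G \<Longrightarrow> satisfies G s \<phi> \<longleftrightarrow> satisfies H (f \<circ> s) \<phi>"
proof (induction \<phi> arbitrary: s)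
  case (Eq x y)
  then show ?case using bij by (auto simp: bij_betw_def dest: inj_onD)
next
  case (Adj x y)
  then show ?case using adj by auto
next
  case (Neg \<phi>)
  then show ?case by simp
next
  case (Disj \<phi> \<psi>)
  then show ?case by (simp add: image_Un)
next
  case (Ex x \<phi>)
  have IH: "satisfies G (s(x := v)) \<phi> \<longleftrightarrow> satisfies H ((f \<circ> s)(x := f v)) \<phi>"
    if "v \<in> pverts G" for v
  proof -
    have "s(x := v) ` free_vars \<phi> \<subseteq> pverts G" using Ex.prems that by auto
    from Ex.IH[OF this] show ?thesis by (simp only: fun_upd_comp)
  qed
  have "pverts H = f ` pverts G" using bij by (simp add: bij_betw_def)
  then show ?case by (simp only: satisfies.simps bex_simps IH cong: bex_cong)
next
  case (ExGe d x \<phi>)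
  have IH: "satisfies G (s(x := v)) \<phi> \<longleftrightarrow> satisfies H ((f \<circ> s)(x := f v)) \<phi>"
    if "v \<in> pverts G" for v
  proof -
    have "s(x := v) ` free_vars \<phi> \<subseteq> pverts G" using ExGe.prems that by auto
    from ExGe.IH[OF this] show ?thesis by (simp only: fun_upd_comp)
  qed
  have "{v \<in> pverts H. satisfies H ((f \<circ> s)(x := v)) \<phi>} =
      f ` {v \<in> pverts G. satisfies G (s(x := v)) \<phi>}"
  proof -
    have "pverts H = f ` pverts G" using bij by (simp add: bij_betw_def)
    then show ?thesis using IH by auto
  qed
  moreover have "inj_on f {v \<in> pverts G. satisfies G (s(x := v)) \<phi>}"
    using bij by (auto simp: bij_betw_def intro: inj_on_subset)
  ultimately show ?case by (simp only: satisfies.simps card_image)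
qed

lemma iso_imp_C2_equivalent:
  assumes "bij_betw f (pverts G) (pverts H)"
    and "\<forall>u\<in>pverts G. \<forall>v\<in>pverts G. (u, v) \<in> parcs G \<longleftrightarrow> (f u, f v) \<in> parcs H"
  shows "C2_equivalent G H"
  unfolding C2_equivalent_def
proof (intro allI impI)
  fix \<phi> assume "C2_sentence \<phi>"
  then have "free_vars \<phi> = {}" by (simp add: C2_sentence_def)
  then show "models G \<phi> \<longleftrightarrow> models H \<phi>"
    using satisfies_iso[OF assms, of undefined \<phi>] models_iff_satisfies[of \<phi> G undefined]
      models_iff_satisfies[of \<phi> H "f \<circ> undefined"] by simp
qed


section \<open>Types\<close>

definition Conj :: "fm \<Rightarrow> fm \<Rightarrow> fm" where
  "Conj \<phi> \<psi> = Neg (Disj (Neg \<phi>) (Neg \<psi>))"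

lemma Conj_simps [simp]:
  "vars (Conj \<phi> \<psi>) = vars \<phi> \<union> vars \<psi>"
  "free_vars (Conj \<phi> \<psi>) = free_vars \<phi> \<union> free_vars \<psi>"
  "satisfies G s (Conj \<phi> \<psi>) \<longleftrightarrow> satisfies G s \<phi> \<and> satisfies G s \<psi>"
  by (auto simp: Conj_def)

section \<open>Exchanging the two variables\<close>

abbreviation swap01 :: "nat \<Rightarrow> nat" where
  "swap01 \<equiv> Transposition.transpose 0 1"

text \<open>Bound variables are renamed too: an involution on all names cannot cause capture, and
  formulas over the variables 0 and 1 stay over them.\<close>

primrec swap_fm :: "fm \<Rightarrow> fm" where
  "swap_fm (Eq x y) = Eq (swap01 x) (swap01 y)"
| "swap_fm (Adj x y) = Adj (swap01 x) (swap01 y)"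
| "swap_fm (Neg \<phi>) = Neg (swap_fm \<phi>)"
| "swap_fm (Disj \<phi> \<psi>) = Disj (swap_fm \<phi>) (swap_fm \<psi>)"
| "swap_fm (Ex x \<phi>) = Ex (swap01 x) (swap_fm \<phi>)"
| "swap_fm (ExGe d x \<phi>) = ExGe d (swap01 x) (swap_fm \<phi>)"

lemma vars_swap_fm: "vars (swap_fm \<phi>) = swap01 ` vars \<phi>"
  by (induction \<phi>) auto

lemma free_vars_swap_fm: "free_vars (swap_fm \<phi>) = swap01 ` free_vars \<phi>"
  by (induction \<phi>) (auto simp: image_set_diff)

lemma satisfies_swap_fm: "satisfies G s (swap_fm \<phi>) \<longleftrightarrow> satisfies G (s \<circ> swap01) \<phi>"
proof -
  have "s(swap01 x := v) \<circ> swap01 = (s \<circ> swap01)(x := v)" for s :: "nat \<Rightarrow> 'a" and x v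
    by (auto simp: fun_eq_iff transpose_eq_iff)
  then show ?thesis by (induction \<phi> arbitrary: s) simp_all
qed

definition C2_unary :: "fm set" where
  "C2_unary = {\<phi>. vars \<phi> \<subseteq> {0, 1} \<and> free_vars \<phi> \<subseteq> {0}}"

text \<open>Only the value at variable 0 matters; the constant assignment fills the rest.\<close>

definition C2_type :: "'a pair_pre_digraph \<Rightarrow> 'a \<Rightarrow> fm set" where
  "C2_type G v = {\<phi> \<in> C2_unary. satisfies G (\<lambda>_. v) \<phi>}"

lemma satisfies_unary:
  "\<phi> \<in> C2_unary \<Longrightarrow> satisfies G s \<phi> \<longleftrightarrow> \<phi> \<in> C2_type G (s 0)"
  unfolding C2_type_def C2_unary_def using satisfies_cong[of \<phi> s "\<lambda>_. s 0" G] by auto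

lemma satisfies_swap_unary:
  "\<phi> \<in> C2_unary \<Longrightarrow> satisfies G s (swap_fm \<phi>) \<longleftrightarrow> \<phi> \<in> C2_type G (s 1)"
  by (simp add: satisfies_swap_fm satisfies_unary)

lemma unary_swap:
  assumes "\<phi> \<in> C2_unary"
  shows "vars (swap_fm \<phi>) \<subseteq> {0, 1}" "free_vars (swap_fm \<phi>) \<subseteq> {1}"
proof -
  have "swap01 ` {0, 1} = {0, 1}" "swap01 ` {0} = {1}" by auto
  then show "vars (swap_fm \<phi>) \<subseteq> {0, 1}" "free_vars (swap_fm \<phi>) \<subseteq> {1}"
    using assms image_mono[of "vars \<phi>" "{0, 1}" swap01] image_mono[of "free_vars \<phi>" "{0}" swap01]
    by (simp_all only: C2_unary_def vars_swap_fm free_vars_swap_fm mem_Collect_eq)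
qed

lemma C2_sentenceI: "vars \<phi> \<subseteq> {0, 1} \<Longrightarrow> free_vars \<phi> = {} \<Longrightarrow> C2_sentence \<phi>"
  unfolding C2_sentence_def using card_mono[of "{0, 1}" "vars \<phi>"] by simp

text \<open>
  An abstract stand-in for \<open>t = C2_type G v\<close>, as the finite sets of types considered below come
  from two graphs whose vertices may have different HOL types.
\<close>

definition complete :: "fm set \<Rightarrow> bool" where
  "complete t \<longleftrightarrow> t \<subseteq> C2_unary \<and> Eq 0 0 \<in> t \<and> (\<forall>\<phi>\<in>C2_unary. Neg \<phi> \<in> t \<longleftrightarrow> \<phi> \<notin> t) \<and>
    (\<forall>\<phi>\<in>C2_unary. \<forall>\<psi>\<in>C2_unary. Conj \<phi> \<psi> \<in> t \<longleftrightarrow> \<phi> \<in> t \<and> \<psi> \<in> t)"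

lemma complete_C2_type: "complete (C2_type G v)"
  by (auto simp: complete_def C2_type_def C2_unary_def)

text \<open>If the two sets differ by a formula of \<open>t'\<close>, its negation lies in
  \<open>t\<close> and not in \<open>t'\<close>.\<close>

lemma complete_separated:
  assumes "complete t" "complete t'" "t \<noteq> t'"
  shows "\<exists>\<phi>\<in>t. \<phi> \<notin> t'"
proof (rule ccontr)
  assume "\<not> ?thesis"
  then obtain \<phi> where "\<phi> \<in> t'" "\<phi> \<notin> t" "\<forall>\<psi>\<in>t. \<psi> \<in> t'" using assms(3) by blast
  then show False using assms(1,2) unfolding complete_def by (meson subsetD)
qed

text \<open>Conjoin one formula for each other member of \<open>T\<close>, separating
  \<open>t\<close> from it. As \<open>t\<close> is not assumed to lie in \<open>T\<close>, the
  induction can start from the empty set.\<close>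

lemma complete_isolated:
  assumes "finite T" "\<forall>t\<in>T. complete t" "complete t"
  shows "\<exists>\<chi>\<in>t. \<forall>t'\<in>T. \<chi> \<in> t' \<longrightarrow> t' = t"
  using assms
proof (induction T rule: finite_induct)
  case empty
  \<comment> \<open>\<open>Eq 0 0\<close> serves as the empty conjunction.\<close>
  then show ?case by (auto simp: complete_def)
next
  case (insert t1 T)
  then obtain \<chi> where \<chi>: "\<chi> \<in> t" "\<forall>t'\<in>T. \<chi> \<in> t' \<longrightarrow> t' = t" by auto
  show ?case
  proof (cases "t1 = t")
    case True
    with \<chi> show ?thesis by auto
  next
    case False
    then obtain \<phi> where \<phi>: "\<phi> \<in> t" "\<phi> \<notin> t1"
      using complete_separated[of t t1] insert.prems by auto
    have u: "\<phi> \<in> C2_unary" "\<chi> \<in> C2_unary" using \<phi> \<chi> insert.prems by (auto simp: complete_def)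
    have "Conj \<phi> \<chi> \<in> t' \<longleftrightarrow> \<phi> \<in> t' \<and> \<chi> \<in> t'" if "t' \<in> insert t (insert t1 T)" for t'
      using that u insert.prems by (auto simp: complete_def)
    then show ?thesis using \<phi> \<chi> by (intro bexI[of _ "Conj \<phi> \<chi>"]) auto
  qed
qed

text \<open>\<open>T\<close> will hold the types of both graphs, so that one formula picks out the
  same type in each.\<close>

definition isolating :: "(fm set \<Rightarrow> fm) \<Rightarrow> fm set set \<Rightarrow> bool" where
  "isolating \<chi> T \<longleftrightarrow>
    finite T \<and> (\<forall>t\<in>T. \<chi> t \<in> C2_unary \<and> (\<forall>t'\<in>T. \<chi> t \<in> t' \<longleftrightarrow> t' = t))"

lemma isolating_exists:
  assumes "finite T" "\<forall>t\<in>T. complete t"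
  shows "\<exists>\<chi>. isolating \<chi> T"
proof -
  have "\<exists>\<chi>. \<chi> \<in> t \<and> (\<forall>t'\<in>T. \<chi> \<in> t' \<longrightarrow> t' = t)" if "t \<in> T" for t
    using complete_isolated[OF assms, of t] assms(2) that by blast
  then obtain \<chi> where \<chi>: "\<chi> t \<in> t" "t' \<in> T \<Longrightarrow> \<chi> t \<in> t' \<Longrightarrow> t' = t" if "t \<in> T" for t t'
    by metis
  have "\<chi> t \<in> C2_unary" if "t \<in> T" for t
    using \<chi>(1)[OF that] assms(2) that by (auto simp: complete_def)
  with \<chi> assms(1) have "isolating \<chi> T" unfolding isolating_def by metis
  then show ?thesis by blast
qed


section \<open>Walk counts are determined by types\<close>

text \<open>The swapped copy speaks of the neighbour at variable 1 and may quantify 0 again, so two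
  variables suffice.\<close>

definition nbr_fm :: "nat \<Rightarrow> fm \<Rightarrow> fm" where
  "nbr_fm d \<phi> = ExGe d 1 (Conj (Adj 0 1) (swap_fm \<phi>))"

text \<open>
  If exactly \<open>c\<close> neighbours satisfy \<open>\<phi>\<close>, then the \<open>d\<close> for which \<open>nbr_fm (Suc d) \<phi>\<close> holds are those
  below \<open>c\<close>, so that their number is \<open>c\<close>.
\<close>

primrec type_walks :: "(fm set \<Rightarrow> fm) \<Rightarrow> fm set set \<Rightarrow> nat \<Rightarrow> fm set \<Rightarrow> nat" where
  "type_walks \<chi> T 0 t = 1"
| "type_walks \<chi> T (Suc k) t =
    (\<Sum>t'\<in>T. card {d. nbr_fm (Suc d) (\<chi> t') \<in> t} * type_walks \<chi> T k t')"

context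
  fixes G :: "'a pair_pre_digraph" and \<chi> T
  assumes iso: "isolating \<chi> T" and types: "C2_type G ` pverts G \<subseteq> T"
begin

lemma satisfies_isolating:
  assumes "t \<in> T"
  shows "s 0 \<in> pverts G \<Longrightarrow> satisfies G s (\<chi> t) \<longleftrightarrow> C2_type G (s 0) = t"
    and "s 1 \<in> pverts G \<Longrightarrow> satisfies G s (swap_fm (\<chi> t)) \<longleftrightarrow> C2_type G (s 1) = t"
  using assms iso types
  by (auto simp: isolating_def satisfies_unary satisfies_swap_unary simp del: One_nat_def)

lemma card_nbr_fm:
  assumes t: "t \<in> T" and u: "u \<in> pverts G"
  shows "card {d. nbr_fm (Suc d) (\<chi> t) \<in> C2_type G u} =
    card {v \<in> pverts G. (u, v) \<in> parcs G \<and> C2_type G v = t}"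
proof -
  let ?c = "card {v \<in> pverts G. (u, v) \<in> parcs G \<and> C2_type G v = t}"
  have "\<chi> t \<in> C2_unary" using iso t by (auto simp: isolating_def)
  then have "nbr_fm d (\<chi> t) \<in> C2_unary" for d
    using unary_swap[of "\<chi> t"] by (auto simp: nbr_fm_def C2_unary_def)
  moreover have "satisfies G (\<lambda>_. u) (nbr_fm d (\<chi> t)) \<longleftrightarrow> d \<le> ?c" for d
  proof -
    have "{v \<in> pverts G. satisfies G ((\<lambda>_. u)(1 := v)) (Conj (Adj 0 1) (swap_fm (\<chi> t)))} =
        {v \<in> pverts G. (u, v) \<in> parcs G \<and> C2_type G v = t}"
      using satisfies_isolating(2)[OF t] by auto
    then show ?thesis by (simp add: nbr_fm_def)
  qed
  ultimately have "{d. nbr_fm (Suc d) (\<chi> t) \<in> C2_type G u} = {..<?c}"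
    by (auto simp: C2_type_def Suc_le_eq)
  then show ?thesis by simp
qed

text \<open>The right-hand side sees the vertex only through its type, so vertices of equal type
  have equal walk counts.\<close>

lemma walks_eq_type_walks:
  assumes vs: "vertex_enum G vs" and i: "i < length vs"
  shows "((adjacency_mat G vs ^\<^sub>m k) *\<^sub>v ones_vec (length vs)) $ i =
    real (type_walks \<chi> T k (C2_type G (vs ! i)))"
  using i
proof (induction k arbitrary: i)
  case 0
  then show ?case by (simp add: ones_vec_def adjacency_mat_def)
next
  case (Suc k)
  let ?V = "pverts G" and ?w = "type_walks \<chi> T k" and ?u = "vs ! i"
  let ?N = "{v \<in> ?V. (?u, v) \<in> parcs G}"
  have V: "set vs = ?V" using vs by (simp add: vertex_enum_def)
  have fin: "finite ?V" unfolding V[symmetric] by simp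
  have u: "?u \<in> ?V" unfolding V[symmetric] using Suc.prems by simp
  have bij: "bij_betw ((!) vs) {..<length vs} ?V"
    using vs bij_betw_nth[of vs] by (simp add: vertex_enum_def)
  have "((adjacency_mat G vs ^\<^sub>m Suc k) *\<^sub>v ones_vec (length vs)) $ i =
      (\<Sum>j<length vs. (if (?u, vs ! j) \<in> parcs G then 1 else 0) * real (?w (C2_type G (vs ! j))))"
    using Suc by (subst pow_adjacency_Suc) (auto intro!: sum.cong simp del: pow_mat.simps)
  also have "\<dots> = (\<Sum>v\<in>?V. (if (?u, v) \<in> parcs G then 1 else 0) * real (?w (C2_type G v)))"
    by (rule sum.reindex_bij_betw[OF bij])
  also have "\<dots> = (\<Sum>v\<in>?N. real (?w (C2_type G v)))"
    using fin by (simp add: sum.inter_filter if_distrib[of "\<lambda>x. x * _"] cong: if_cong)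
  \<comment> \<open>Members of \<open>T\<close> that are the type of no neighbour contribute empty
    sums.\<close>
  also have "\<dots> = (\<Sum>t\<in>T. \<Sum>v\<in>{v \<in> ?N. C2_type G v = t}. real (?w (C2_type G v)))"
    using fin iso types by (intro sum.group[symmetric]) (auto simp: isolating_def)
  also have "\<dots> = (\<Sum>t\<in>T. real (card {v \<in> ?N. C2_type G v = t}) * real (?w t))"
    by (intro sum.cong) auto
  also have "\<dots> = real (type_walks \<chi> T (Suc k) (C2_type G ?u))"
    using card_nbr_fm[OF _ u] by (simp add: conj_assoc)
  finally show ?case .
qed

text \<open>Equal types give equal rows of the walk matrix, and an invertible matrix has no repeated
  row.\<close>

lemma inj_on_C2_type:
  assumes "controllable G"
  shows "inj_on (C2_type G) (pverts G)"
proof (rule inj_onI)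
  obtain vs where vs: "vertex_enum G vs" and inv: "invertible_mat (walk_mat G vs)"
    using assms by (auto simp: controllable_def)
  let ?n = "length vs" and ?W = "walk_mat G vs"
  obtain B where B: "?W * B = 1\<^sub>m ?n"
    using inv by (auto simp: invertible_mat_def inverts_mat_def)
  have dimB: "dim_col B = ?n" using arg_cong[OF B, of dim_col] by simp
  fix u v assume "u \<in> pverts G" "v \<in> pverts G" and eq: "C2_type G u = C2_type G v"
  then obtain i j where ij: "i < ?n" "j < ?n" "u = vs ! i" "v = vs ! j"
    using vs by (metis in_set_conv_nth vertex_enum_def)
  have "row ?W i = row ?W j"
    using ij eq by (intro eq_vecI) (simp_all add: walk_mat_index walks_eq_type_walks[OF vs])
  \<comment> \<open>Equal rows of \<open>?W\<close> give equal rows of the identity matrix; the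
    diagonal entry 1 then also stands at (j, i).\<close>
  then have "(?W * B) $$ (i, i) = (?W * B) $$ (j, i)" using ij dimB by simp
  then have "i = j" using ij unfolding B by (simp split: if_splits)
  then show "u = v" using ij by simp
qed

end


section \<open>Matching vertices by type\<close>

lemma C2_equivalent_sym: "C2_equivalent G H \<Longrightarrow> C2_equivalent H G"
  by (simp add: C2_equivalent_def)

text \<open>The assignments are unrelated, so one side may use a chosen vertex and the other a
  default value.\<close>

lemma C2_equivalent_satisfies:
  assumes "C2_equivalent G H" "vars \<phi> \<subseteq> {0, 1}" "free_vars \<phi> = {}" "satisfies G s \<phi>"
  shows "satisfies H s' \<phi>"
  using assms(1,4) C2_sentenceI[OF assms(2,3)] models_iff_satisfies[OF assms(3), of G s]
    models_iff_satisfies[OF assms(3), of H s']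
  by (simp add: C2_equivalent_def)

text \<open>The sentence \<open>Ex 0 (\<chi> t)\<close>, for \<open>t\<close> the type of
  \<open>u\<close>, is transferred from \<open>G\<close> to \<open>H\<close>.\<close>

lemma C2_equivalent_type:
  assumes eqv: "C2_equivalent G H" and iso: "isolating \<chi> T"
    and types: "C2_type G ` pverts G \<subseteq> T" "C2_type H ` pverts H \<subseteq> T"
    and u: "u \<in> pverts G"
  shows "\<exists>v\<in>pverts H. C2_type H v = C2_type G u"
proof -
  let ?t = "C2_type G u"
  have t: "?t \<in> T" using types u by auto
  then have "\<chi> ?t \<in> C2_unary" using iso by (simp add: isolating_def)
  then have "vars (Ex 0 (\<chi> ?t)) \<subseteq> {0, 1}" "free_vars (Ex 0 (\<chi> ?t)) = {}"
    by (auto simp: C2_unary_def)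
  moreover have "satisfies G (\<lambda>_. u) (Ex 0 (\<chi> ?t))"
    using u satisfies_isolating(1)[OF iso types(1) t] by auto
  ultimately have "satisfies H (\<lambda>_. undefined) (Ex 0 (\<chi> ?t))"
    by (rule C2_equivalent_satisfies[OF eqv])
  then show ?thesis using satisfies_isolating(1)[OF iso types(2) t] by auto
qed

text \<open>The ends of the arc are found only up to type; injectivity of types identifies them
  later.\<close>

lemma C2_equivalent_arc:
  assumes eqv: "C2_equivalent G H" and iso: "isolating \<chi> T"
    and types: "C2_type G ` pverts G \<subseteq> T" "C2_type H ` pverts H \<subseteq> T"
    and uv: "u \<in> pverts G" "v \<in> pverts G" "(u, v) \<in> parcs G"
  shows "\<exists>u'\<in>pverts H. \<exists>v'\<in>pverts H.
    C2_type H u' = C2_type G u \<and> C2_type H v' = C2_type G v \<and> (u', v') \<in> parcs H"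
proof -
  let ?t = "C2_type G u" and ?t' = "C2_type G v"
  let ?\<phi> = "Ex 0 (Conj (\<chi> ?t) (Ex 1 (Conj (Adj 0 1) (swap_fm (\<chi> ?t')))))"
  have t: "?t \<in> T" "?t' \<in> T" using types uv by auto
  then have *: "\<chi> ?t \<in> C2_unary" "\<chi> ?t' \<in> C2_unary" using iso by (simp_all add: isolating_def)
  then have "vars ?\<phi> \<subseteq> {0, 1}" "free_vars ?\<phi> = {}"
    using unary_swap[OF *(2)] by (auto simp: C2_unary_def)
  moreover have "satisfies G (\<lambda>_. u) ?\<phi>"
    using uv satisfies_isolating[OF iso types(1)] t by auto
  ultimately have "satisfies H (\<lambda>_. undefined) ?\<phi>"
    by (rule C2_equivalent_satisfies[OF eqv])
  then show ?thesis using satisfies_isolating[OF iso types(2)] t by auto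
qed

lemma C2_equivalent_imp_iso:
  assumes fin: "finite (pverts G)" "finite (pverts H)"
    and ctrl: "controllable G" "controllable H" and eqv: "C2_equivalent G H"
  shows "\<exists>f. bij_betw f (pverts G) (pverts H) \<and>
    (\<forall>u\<in>pverts G. \<forall>v\<in>pverts G. (u, v) \<in> parcs G \<longleftrightarrow> (f u, f v) \<in> parcs H)"
proof -
  define T where "T = C2_type G ` pverts G \<union> C2_type H ` pverts H"
  have "finite T" "\<forall>t\<in>T. complete t" using fin by (auto simp: T_def complete_C2_type)
  then obtain \<chi> where iso: "isolating \<chi> T" using isolating_exists by blast
  have types: "C2_type G ` pverts G \<subseteq> T" "C2_type H ` pverts H \<subseteq> T" by (auto simp: T_def)
  note eqv' = C2_equivalent_sym[OF eqv]
  have injG: "inj_on (C2_type G) (pverts G)" and injH: "inj_on (C2_type H) (pverts H)"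
    using inj_on_C2_type[OF iso] types ctrl by auto
  \<comment> \<open>\<open>f u\<close> is the vertex of \<open>H\<close> with the type of
    \<open>u\<close>: it exists by \<open>same\<close> below and is unique by
    \<open>injH\<close>.\<close>
  define f where "f = inv_into (pverts H) (C2_type H) \<circ> C2_type G"
  have same: "C2_type G ` pverts G = C2_type H ` pverts H"
  proof (intro equalityI subsetI)
    fix t assume "t \<in> C2_type G ` pverts G"
    then show "t \<in> C2_type H ` pverts H"
      using C2_equivalent_type[OF eqv iso types] by force
  next
    fix t assume "t \<in> C2_type H ` pverts H"
    then show "t \<in> C2_type G ` pverts G"
      using C2_equivalent_type[OF eqv' iso types(2,1)] by force
  qed
  have bij: "bij_betw f (pverts G) (pverts H)"
    unfolding f_def
    by (rule bij_betw_trans[OF inj_on_imp_bij_betw[OF injG]])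
      (simp add: same bij_betw_inv_into inj_on_imp_bij_betw[OF injH])
  have f: "f u \<in> pverts H" "C2_type H (f u) = C2_type G u" if "u \<in> pverts G" for u
  proof -
    have "C2_type G u \<in> C2_type H ` pverts H" using that same by blast
    then show "f u \<in> pverts H" "C2_type H (f u) = C2_type G u"
      by (simp_all add: f_def inv_into_into f_inv_into_f)
  qed
  have "(u, v) \<in> parcs G \<longleftrightarrow> (f u, f v) \<in> parcs H" if uv: "u \<in> pverts G" "v \<in> pverts G" for u v
  proof
    assume "(u, v) \<in> parcs G"
    then obtain u' v' where *: "u' \<in> pverts H" "v' \<in> pverts H" "C2_type H u' = C2_type H (f u)"
        "C2_type H v' = C2_type H (f v)" "(u', v') \<in> parcs H"
      using C2_equivalent_arc[OF eqv iso types uv] f uv by auto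
    then have "u' = f u" "v' = f v"
      using inj_onD[OF injH, of u' "f u"] inj_onD[OF injH, of v' "f v"] f(1) uv by auto
    with * show "(f u, f v) \<in> parcs H" by simp
  next
    \<comment> \<open>Non-adjacency needs no sentence of its own: arcs are carried back by the
      equivalence in the other direction.\<close>
    assume "(f u, f v) \<in> parcs H"
    then obtain u' v' where *: "u' \<in> pverts G" "v' \<in> pverts G" "C2_type G u' = C2_type G u"
        "C2_type G v' = C2_type G v" "(u', v') \<in> parcs G"
      using C2_equivalent_arc[OF eqv' iso types(2,1) f(1)[OF uv(1)] f(1)[OF uv(2)]] f(2)[OF uv(1)] f(2)[OF uv(2)]
      by auto
    then have "u' = u" "v' = v"
      using inj_onD[OF injG, of u' u] inj_onD[OF injG, of v' v] uv by auto
    with * show "(u, v) \<in> parcs G" by simp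
  qed
  with bij show ?thesis by blast
qed

theorem theorem6:
  fixes G :: "'a pair_pre_digraph" and H :: "'b pair_pre_digraph"
  assumes "pair_graph G" and "pair_graph H"
    and "controllable G" and "controllable H"
  shows "digraph_iso (with_proj G) (with_proj H) \<longleftrightarrow> C2_equivalent G H"
proof -
  interpret G: pair_graph G by fact
  interpret H: pair_graph H by fact
  show ?thesis
    unfolding digraph_iso_with_proj_iff[OF G.pair_wf_digraph_axioms H.pair_wf_digraph_axioms]
    using iso_imp_C2_equivalent
      C2_equivalent_imp_iso[OF G.pair_finite_verts H.pair_finite_verts assms(3,4)] by auto
qed

end
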